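(* Let $(X,\mu)$ be a non-atomic Lebesgue space with a $\sigma$-finite measure such that $\mu(X)=\infty$. If $T:X\to X$ is ergodic and measure-preserving, then $T$ is not measurably sensitive. That is, there are no ergodic, infinite measure-preserving, measurably sensitive transformations.
   Context: A metric $d$ on a measure space is good if all nonempty open sets have positive measure; when a space carries a good metric, the measure on it is assumed to be regular (so open sets are measurable). $B_\varepsilon(x)$ denotes the open $d$-ball of radius $\varepsilon$ about $x$. Two systems $(X,\mu,T)$ and $(X_1,\mu_1,T_1)$ are measure-theoretically isomorphic if, after discarding null sets (with forward-invariant complements), there is a bimeasurable bijection between them that carries $\mu$ to $\mu_1$ and intertwines $T$ and $T_1$. $T$ is measurably sensitive if whenever $(X_1,\mu_1,T_1)$ is measure-theoretically isomorphic to $(X,\mu,T)$ and $d$ is a good metric on $X_1$, there exists $\delta>0$ such that for all $x\in X_1$ and all $\varepsilon>0$ there exists $N\in\mathbb{N}$ such that for all integers $n\ge N$, $\mu_1\{y\in B_\varepsilon(x): d(T_1^n(x),T_1^n(y))>\delta\}>0$. *)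

theory Defs
  imports "HOL-Analysis.Analysis"
begin

definition measure_isomorphism :: "'a measure \<Rightarrow> 'b measure \<Rightarrow> ('a \<Rightarrow> 'b) \<Rightarrow> bool" where
  "measure_isomorphism M N \<phi> \<longleftrightarrow>
     bij_betw \<phi> (space M) (space N) \<and>
     \<phi> \<in> measurable M N \<and>
     the_inv_into (space M) \<phi> \<in> measurable N M \<and>
     (\<forall>A\<in>sets N. emeasure M (\<phi> -` A \<inter> space M) = emeasure N A)"

(* A Lebesgue space is, up to a null set, an interval with Lebesgue measure (on the Lebesgue,
   not merely Borel, measurable sets) together with countably many atoms. The interval may be
   empty, bounded or unbounded; sigma-finiteness is imposed separately. *)
definition lebesgue_space :: "'a measure \<Rightarrow> bool" where
  "lebesgue_space M \<longleftrightarrow>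
     (\<exists>C\<in>sets M. \<exists>D\<in>sets M. \<exists>I :: real set. \<exists>\<phi>.
        C \<inter> D = {} \<and> emeasure M (space M - (C \<union> D)) = 0 \<and>
        countable D \<and> (\<forall>x\<in>D. {x} \<in> sets M \<and> emeasure M {x} > 0) \<and>
        is_interval I \<and> measure_isomorphism (restrict_space M C) (lebesgue_on I) \<phi>)"

definition nonatomic :: "'a measure \<Rightarrow> bool" where
  "nonatomic M \<longleftrightarrow>
     \<not> (\<exists>A\<in>sets M. emeasure M A > 0 \<and>
          (\<forall>B\<in>sets M. B \<subseteq> A \<longrightarrow> emeasure M B = 0 \<or> emeasure M (A - B) = 0))"

definition measure_preserving_map :: "'a measure \<Rightarrow> ('a \<Rightarrow> 'a) \<Rightarrow> bool" where
  "measure_preserving_map M T \<longleftrightarrow>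
     T \<in> measurable M M \<and> (\<forall>A\<in>sets M. emeasure M (T -` A \<inter> space M) = emeasure M A)"

definition ergodic_map :: "'a measure \<Rightarrow> ('a \<Rightarrow> 'a) \<Rightarrow> bool" where
  "ergodic_map M T \<longleftrightarrow>
     T \<in> measurable M M \<and>
     (\<forall>A\<in>sets M. T -` A \<inter> space M = A \<longrightarrow>
        emeasure M A = 0 \<or> emeasure M (space M - A) = 0)"

definition systems_isomorphic ::
  "'a measure \<Rightarrow> ('a \<Rightarrow> 'a) \<Rightarrow> 'b measure \<Rightarrow> ('b \<Rightarrow> 'b) \<Rightarrow> bool" where
  "systems_isomorphic M T N S \<longleftrightarrow>
     (\<exists>X\<in>sets M. \<exists>Y\<in>sets N. \<exists>\<phi>.
        emeasure M (space M - X) = 0 \<and> emeasure N (space N - Y) = 0 \<and>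
        T ` X \<subseteq> X \<and> S ` Y \<subseteq> Y \<and>
        measure_isomorphism (restrict_space M X) (restrict_space N Y) \<phi> \<and>
        (\<forall>x\<in>X. \<phi> (T x) = S (\<phi> x)))"

definition regular_for_metric :: "'a measure \<Rightarrow> ('a \<Rightarrow> 'a \<Rightarrow> real) \<Rightarrow> bool" where
  "regular_for_metric M d \<longleftrightarrow>
     (\<forall>U. openin (Metric_space.mtopology (space M) d) U \<longrightarrow> U \<in> sets M) \<and>
     (\<forall>A\<in>sets M.
        emeasure M A =
          (INF U\<in>{U. openin (Metric_space.mtopology (space M) d) U \<and> A \<subseteq> U}. emeasure M U) \<and>
        emeasure M A =
          (SUP K\<in>{K. compactin (Metric_space.mtopology (space M) d) K \<and> K \<subseteq> A}. emeasure M K))"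

(* The regularity of the measure is a standing assumption accompanying every good metric,
   so it is made part of the notion. *)
definition good_metric :: "'a measure \<Rightarrow> ('a \<Rightarrow> 'a \<Rightarrow> real) \<Rightarrow> bool" where
  "good_metric M d \<longleftrightarrow>
     Metric_space (space M) d \<and> regular_for_metric M d \<and>
     (\<forall>U. openin (Metric_space.mtopology (space M) d) U \<and> U \<noteq> {} \<longrightarrow> emeasure M U > 0)"

(* HOL cannot quantify over types inside a definition, so the type 'b carrying the isomorphic
   copies is a parameter. Taking 'b = real loses no copies of a sigma-finite system: if all
   nonempty open sets have positive sigma-finite measure, disjoint families of them are
   countable, so the metric space is separable and has at most continuum many points; it can
   therefore be transported to a subset of the reals. Failure of the property at one type 'b
   is failure of the unrestricted property. *)
definition measurably_sensitive :: "'b itself \<Rightarrow> 'a measure \<Rightarrow> ('a \<Rightarrow> 'a) \<Rightarrow> bool" where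
  "measurably_sensitive (_ :: 'b itself) M T \<longleftrightarrow>
     (\<forall>(N :: 'b measure) S d.
        S \<in> measurable N N \<and> systems_isomorphic M T N S \<and> good_metric N d \<longrightarrow>
        (\<exists>\<delta>>0. \<forall>x\<in>space N. \<forall>\<epsilon>>0. \<exists>n0::nat. \<forall>n\<ge>n0.
           emeasure N {y \<in> Metric_space.mball (space N) d x \<epsilon>.
             d ((S ^^ n) x) ((S ^^ n) y) > \<delta>} > 0))"

end

(* An ergodic infinite measure-preserving T has mu(A \<inter> T^{-n} C) arbitrarily small for suitable
   large n whenever A and C have finite measure: otherwise the functions g with 0 \<le> g \<le> 1, integral
   at most mu(C), and integrals of all g o T^n over A bounded below form a convex set invariant
   under composition with T, and a minimising sequence for the L2 norm on it converges a.e. to a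
   nonzero integrable T-invariant function. Subtracting from A the sets T^{-n_k} C_k for an exhaustion
   C_k by sets of finite measure leaves a set B of positive measure with T^{n_k} B disjoint from C_k.
   Realise the system on a subset of the real line with C_k = {|x| \<le> k}, wrap the line around a
   circle, so that the complement of C_k becomes small, and separate B from its complement by
   adding 1 to the mutual distances. In this good metric B is open, while T^{n_k} B has diameter
   tending to 0, so no sensitivity constant exists. *)
theory Submission
  imports Defs
begin

section \<open>Measure-preserving maps and invariance up to null sets\<close>

lemma measure_preserving_map_measurable:
  "measure_preserving_map M T \<Longrightarrow> T \<in> measurable M M"
  by (simp add: measure_preserving_map_def)

lemma measure_preserving_map_funpow:
  assumes "measure_preserving_map M T"
  shows "measure_preserving_map M (T ^^ n)"
proof (induction n)
  case 0
  then show ?case by (auto simp: measure_preserving_map_def)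
next
  case (Suc n)
  have m: "T \<in> measurable M M" "(T ^^ n) \<in> measurable M M"
    using assms Suc by (auto simp: measure_preserving_map_def)
  have "emeasure M ((T ^^ Suc n) -` A \<inter> space M) = emeasure M A" if A: "A \<in> sets M" for A
  proof -
    have "(T ^^ Suc n) -` A \<inter> space M = (T ^^ n) -` (T -` A \<inter> space M) \<inter> space M"
      using measurable_space[OF m(2)] by auto
    then show ?thesis
      using assms Suc A measurable_sets[OF m(1) A] by (auto simp: measure_preserving_map_def)
  qed
  moreover have "T ^^ Suc n \<in> measurable M M"
    using measurable_comp[OF m(2,1)] by simp
  ultimately show ?case unfolding measure_preserving_map_def by blast
qed

lemma distr_measure_preserving_map:
  assumes "measure_preserving_map M T"
  shows "distr M M T = M"
  using assms by (intro measure_eqI) (auto simp: emeasure_distr measure_preserving_map_def)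

lemma AE_measure_preserving_map:
  assumes "measure_preserving_map M T" and "AE x in M. P x"
  shows "AE x in M. P (T x)"
  by (rule AE_distrD[OF measure_preserving_map_measurable[OF assms(1)]])
    (subst distr_measure_preserving_map[OF assms(1)], rule assms(2))

lemma nn_integral_measure_preserving_map:
  assumes "measure_preserving_map M T" and "f \<in> borel_measurable M"
  shows "(\<integral>\<^sup>+x. f (T x) \<partial>M) = (\<integral>\<^sup>+x. f x \<partial>M)"
  using nn_integral_distr[OF measure_preserving_map_measurable[OF assms(1)] , of f] assms(2)
  by (simp add: distr_measure_preserving_map[OF assms(1)])

text \<open>\<open>ergodic_map\<close> constrains only strictly invariant sets. The points whose
  orbit eventually stays in \<open>B\<close> form such a set, because dropping the first orbit point
  does not change the tail, and almost every orbit lies wholly inside or wholly outside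
  \<open>B\<close>.\<close>

lemma ergodic_map_AE_invariant:
  assumes mp: "measure_preserving_map M T" and erg: "ergodic_map M T"
    and B: "B \<in> sets M" and inv: "AE x in M. T x \<in> B \<longleftrightarrow> x \<in> B"
  shows "(AE x in M. x \<notin> B) \<or> (AE x in M. x \<in> B)"
proof -
  have [measurable]: "T ^^ n \<in> measurable M M" for n
    using measure_preserving_map_measurable[OF measure_preserving_map_funpow[OF mp]] .
  note [measurable] = B
  \<comment> \<open>a strictly invariant set that agrees with \<open>B\<close> almost everywhere\<close>
  define E where "E = {x \<in> space M. \<exists>n. \<forall>m\<ge>n. (T ^^ m) x \<in> B}"
  have E: "E \<in> sets M" unfolding E_def by measurable
  have "(\<exists>n. \<forall>m\<ge>n. (T ^^ m) (T x) \<in> B) \<longleftrightarrow> (\<exists>n. \<forall>m\<ge>n. (T ^^ m) x \<in> B)" for x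
  proof -
    have eq: "(T ^^ m) (T x) = (T ^^ Suc m) x" for m by (simp add: funpow_swap1)
    show ?thesis unfolding eq
      by (metis Suc_le_D Suc_le_mono le_SucI)
  qed
  then have "T -` E \<inter> space M = E"
    using measurable_space[OF measure_preserving_map_measurable[OF mp]] by (auto simp: E_def)
  then have dich: "emeasure M E = 0 \<or> emeasure M (space M - E) = 0"
    using erg E by (auto simp: ergodic_map_def)
  have "AE x in M. (T ^^ n) x \<in> B \<longleftrightarrow> x \<in> B" for n
  proof (induction n)
    case (Suc n)
    show ?case using Suc AE_measure_preserving_map[OF measure_preserving_map_funpow[OF mp, of n] inv]
      by eventually_elim simp
  qed simp
  then have "AE x in M. \<forall>n. (T ^^ n) x \<in> B \<longleftrightarrow> x \<in> B" by (simp add: AE_all_countable)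
  then have EB: "AE x in M. x \<in> E \<longleftrightarrow> x \<in> B"
    using AE_space by eventually_elim (auto simp: E_def)
  show ?thesis
    using dich
  proof
    assume "emeasure M E = 0"
    then have "AE x in M. x \<notin> E" using E by (intro AE_not_in) (auto simp: null_sets_def)
    then have "AE x in M. x \<notin> B" using EB by eventually_elim simp
    then show ?thesis ..
  next
    assume "emeasure M (space M - E) = 0"
    then have "AE x in M. x \<notin> space M - E" using E by (intro AE_not_in) (auto simp: null_sets_def)
    then have "AE x in M. x \<in> B" using EB AE_space by eventually_elim simp
    then show ?thesis ..
  qed
qed

section \<open>Small intersections in infinite measure by L2 minimisation\<close>

text \<open>Multiplied by 2^n, the squares still have summable integrals, so their weighted sum is
  finite almost everywhere; at such points the weighted squares dominate the series itself up to a
  geometric one.\<close>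

lemma AE_summable_of_square_integral:
  fixes h :: "nat \<Rightarrow> 'a \<Rightarrow> real"
  assumes [measurable]: "\<And>n. h n \<in> borel_measurable M"
    and bound: "\<And>n. (\<integral>\<^sup>+x. ennreal ((h n x)\<^sup>2) \<partial>M) \<le> ennreal (K * (1/4) ^ n)"
    and K: "K \<ge> 0"
  shows "AE x in M. summable (\<lambda>n. h n x)"
proof -
  have "(\<integral>\<^sup>+x. (\<Sum>n. ennreal (2 ^ n * (h n x)\<^sup>2)) \<partial>M) = (\<Sum>n. \<integral>\<^sup>+x. ennreal (2 ^ n * (h n x)\<^sup>2) \<partial>M)"
    by (intro nn_integral_suminf) measurable
  also have "\<dots> \<le> (\<Sum>n. ennreal (K * (1/2) ^ n))"
  proof (intro suminf_le allI)
    fix n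
    have "(\<integral>\<^sup>+x. ennreal (2 ^ n * (h n x)\<^sup>2) \<partial>M) = ennreal (2 ^ n) * (\<integral>\<^sup>+x. ennreal ((h n x)\<^sup>2) \<partial>M)"
      by (simp add: ennreal_mult nn_integral_cmult)
    also have "\<dots> \<le> ennreal (2 ^ n) * ennreal (K * (1/4) ^ n)"
      by (intro mult_left_mono bound) simp
    also have "\<dots> = ennreal (K * (1/2) ^ n)"
      using K by (simp add: ennreal_mult[symmetric] power_divide field_simps flip: power_mult_distrib)
    finally show "(\<integral>\<^sup>+x. ennreal (2 ^ n * (h n x)\<^sup>2) \<partial>M) \<le> ennreal (K * (1/2) ^ n)" .
  qed auto
  also have "\<dots> < \<infinity>"
    using K by (subst suminf_ennreal2) (auto intro!: summable_mult summable_geometric)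
  finally have "AE x in M. (\<Sum>n. ennreal (2 ^ n * (h n x)\<^sup>2)) \<noteq> \<infinity>"
    by (intro nn_integral_PInf_AE) auto
  then show ?thesis
  proof eventually_elim
    case (elim x)
    then have "summable (\<lambda>n. 2 ^ n * (h n x)\<^sup>2)"
      by (intro summable_suminf_not_top) (auto simp: top_unique)
    then have s: "summable (\<lambda>n. (1/2) ^ n + 2 ^ n * (h n x)\<^sup>2)"
      by (intro summable_add summable_geometric) auto
    \<comment> \<open>This is t \<le> 1 + t^2 for t = 2^n |h|, divided by 2^n.\<close>
    have "\<bar>h n x\<bar> \<le> (1/2) ^ n + 2 ^ n * (h n x)\<^sup>2" for n
    proof -
      have "0 \<le> (2 ^ n * \<bar>h n x\<bar> - 1)\<^sup>2 + 2 ^ n * \<bar>h n x\<bar>" by simp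
      then have "2 ^ n * \<bar>h n x\<bar> \<le> 1 + (2 ^ n * \<bar>h n x\<bar>)\<^sup>2"
        unfolding power2_diff power_one by linarith
      then show ?thesis
        by (simp add: power_divide field_simps power2_eq_square)
    qed
    then show ?case by (intro summable_comparison_test'[OF s]) auto
  qed
qed

text \<open>Lets upper and lower bounds on integrals pass to midpoints, which gives the midpoint
  convexity needed in the minimisation.\<close>

lemma nn_integral_average:
  assumes [measurable]: "f \<in> borel_measurable M" "g \<in> borel_measurable M" "A \<in> sets M"
    and nonneg: "\<And>x. 0 \<le> f x" "\<And>x. 0 \<le> g x"
  shows "(\<integral>\<^sup>+x\<in>A. ennreal ((f x + g x) / 2) \<partial>M) =
    ((\<integral>\<^sup>+x\<in>A. ennreal (f x) \<partial>M) + (\<integral>\<^sup>+x\<in>A. ennreal (g x) \<partial>M)) / 2"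
proof -
  have "(\<integral>\<^sup>+x\<in>A. ennreal ((f x + g x) / 2) \<partial>M) =
    (\<integral>\<^sup>+x. (ennreal (f x) * indicator A x + ennreal (g x) * indicator A x) / 2 \<partial>M)"
  proof (rule nn_integral_cong)
    fix x
    have "ennreal ((f x + g x) / 2) = (ennreal (f x) + ennreal (g x)) / 2"
      using nonneg[of x] by (subst divide_ennreal[symmetric]) (auto simp: ennreal_plus)
    then show "ennreal ((f x + g x) / 2) * indicator A x =
        (ennreal (f x) * indicator A x + ennreal (g x) * indicator A x) / 2"
      by (simp add: indicator_def)
  qed
  also have "\<dots> = ((\<integral>\<^sup>+x\<in>A. ennreal (f x) \<partial>M) + (\<integral>\<^sup>+x\<in>A. ennreal (g x) \<partial>M)) / 2"
    by (simp add: nn_integral_divide nn_integral_add)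
  finally show ?thesis .
qed

lemma ennreal_average_bounds:
  fixes a b c :: ennreal
  shows "c \<le> a \<Longrightarrow> c \<le> b \<Longrightarrow> c \<le> (a + b) / 2" and "a \<le> c \<Longrightarrow> b \<le> c \<Longrightarrow> (a + b) / 2 \<le> c"
proof -
  have "(c + c) / 2 = c"
    using ennreal_mult_divide_eq[of 2 c] by (simp add: mult_2[symmetric] mult.commute)
  then show "c \<le> a \<Longrightarrow> c \<le> b \<Longrightarrow> c \<le> (a + b) / 2" "a \<le> c \<Longrightarrow> b \<le> c \<Longrightarrow> (a + b) / 2 \<le> c"
    by (metis add_mono divide_right_mono_ennreal)+
qed

text \<open>Each superlevel set f > 1/(k+1) is almost invariant, hence null or conull. It cannot be
  conull, since f would then exceed a positive constant almost everywhere on a space of infinite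
  measure. As \<open>ennreal\<close> sends negative reals to 0, \<open>fin\<close> bounds only the
  positive part of f, which matches the one-sided conclusion.\<close>

lemma ergodic_infinite_AE_invariant_le_0:
  fixes f :: "'a \<Rightarrow> real"
  assumes mp: "measure_preserving_map M T" and erg: "ergodic_map M T"
    and infinite: "emeasure M (space M) = \<infinity>"
    and f[measurable]: "f \<in> borel_measurable M"
    and inv: "AE x in M. f (T x) = f x"
    and fin: "(\<integral>\<^sup>+x. ennreal (f x) \<partial>M) < \<infinity>"
  shows "AE x in M. f x \<le> 0"
proof -
  have "AE x in M. f x \<le> 1 / Suc k" for k
  proof -
    define B where "B = {x \<in> space M. f x > 1 / Suc k}"
    have B[measurable]: "B \<in> sets M" by (simp add: B_def)
    have "AE x in M. T x \<in> B \<longleftrightarrow> x \<in> B"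
      using inv AE_space
      by eventually_elim
        (use measurable_space[OF measure_preserving_map_measurable[OF mp]] in \<open>auto simp: B_def\<close>)
    from ergodic_map_AE_invariant[OF mp erg B this] show ?thesis
    proof
      assume "AE x in M. x \<notin> B"
      then show ?thesis using AE_space by eventually_elim (auto simp: B_def)
    next
      assume "AE x in M. x \<in> B"
      then have "AE x in M. ennreal (1 / Suc k) \<le> ennreal (f x)"
        by eventually_elim (auto simp: B_def intro: ennreal_leI)
      then have "(\<integral>\<^sup>+x. ennreal (1 / Suc k) \<partial>M) \<le> (\<integral>\<^sup>+x. ennreal (f x) \<partial>M)"
        by (rule nn_integral_mono_AE)
      then have False
        using fin infinite by (simp add: ennreal_mult_top ennreal_eq_0_iff)
      then show ?thesis ..
    qed
  qed
  then have "AE x in M. \<forall>k. f x \<le> 1 / Suc k" by (simp add: AE_all_countable)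
  then show ?thesis
  proof eventually_elim
    case (elim x)
    show ?case
    proof (rule ccontr)
      assume "\<not> f x \<le> 0"
      then obtain k where "inverse (real (Suc k)) < f x" using reals_Archimedean[of "f x"] by auto
      with elim show False by (metis inverse_eq_divide not_le)
    qed
  qed
qed

text \<open>\<open>N\<close> is arbitrary so that escape times can later be chosen tending to
  infinity; the contrary assumption is then a uniform lower bound from time \<open>N\<close>
  on.\<close>

lemma ergodic_infinite_small_intersection:
  assumes mp: "measure_preserving_map M T" and erg: "ergodic_map M T"
    and infinite: "emeasure M (space M) = \<infinity>"
    and [measurable]: "A \<in> sets M" "C \<in> sets M"
    and fin: "emeasure M A \<noteq> \<infinity>" "emeasure M C \<noteq> \<infinity>" and e: "e > 0"
  shows "\<exists>n\<ge>N. emeasure M (A \<inter> (T ^^ n) -` C) < e"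
proof (rule ccontr)
  assume "\<not> ?thesis"
  then have hyp: "e \<le> emeasure M (A \<inter> (T ^^ n) -` C)" if "n \<ge> N" for n
    using that by (meson not_le)
  have Tn[measurable]: "T ^^ n \<in> measurable M M" for n
    using measure_preserving_map_measurable[OF measure_preserving_map_funpow[OF mp]] .
  have T[measurable]: "T \<in> measurable M M" using Tn[of 1] by simp
  \<comment> \<open>The bounds 0 and 1 give domination, the integral bound gives square
    integrability and a limit of finite integral, and the lower bound for all \<open>n\<close>, not
    only for \<open>n\<close> = 0, makes the set stable under composition with
    \<open>T\<close>.\<close>
  define H :: "('a \<Rightarrow> real) set" where
    "H = {g \<in> borel_measurable M. (\<forall>x. 0 \<le> g x \<and> g x \<le> 1) \<and> (\<integral>\<^sup>+x. g x \<partial>M) \<le> emeasure M C \<and>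
       (\<forall>n. e \<le> (\<integral>\<^sup>+x\<in>A. g ((T ^^ n) x) \<partial>M))}"
  have Hm[measurable_dest]: "g \<in> borel_measurable M" if "g \<in> H" for g using that by (simp add: H_def)
  have Hb: "0 \<le> g x" "g x \<le> 1" if "g \<in> H" for g x using that by (auto simp: H_def)
  have Hi: "(\<integral>\<^sup>+x. g x \<partial>M) \<le> emeasure M C" if "g \<in> H" for g using that by (auto simp: H_def)
  have He: "e \<le> (\<integral>\<^sup>+x\<in>A. g ((T ^^ n) x) \<partial>M)" if "g \<in> H" for g n using that by (auto simp: H_def)

  \<comment> \<open>Composing with \<open>T ^^ N\<close> first turns a lower bound valid from time
    \<open>N\<close> on into one valid for every \<open>n\<close>.\<close>
  have base: "(\<lambda>x. indicator C ((T ^^ N) x)) \<in> H"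
  proof -
    have "(\<integral>\<^sup>+x\<in>A. ennreal (indicator C ((T ^^ N) ((T ^^ n) x))) \<partial>M)
        = emeasure M (A \<inter> (T ^^ (N + n)) -` C)" for n
    proof -
      have "A \<inter> (T ^^ (N + n)) -` C = A \<inter> ((T ^^ (N + n)) -` C \<inter> space M)"
        using sets.sets_into_space[OF \<open>A \<in> sets M\<close>] by auto
      also have "\<dots> \<in> sets M" by measurable
      finally have "(\<integral>\<^sup>+x. indicator (A \<inter> (T ^^ (N + n)) -` C) x \<partial>M)
          = emeasure M (A \<inter> (T ^^ (N + n)) -` C)"
        by simp
      then show ?thesis
        by (subst (asm) nn_integral_cong[where v = "\<lambda>x. ennreal (indicator C ((T ^^ N) ((T ^^ n) x))) * indicator A x"])
          (auto simp: indicator_def funpow_add)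
    qed
    moreover have "(\<integral>\<^sup>+x. ennreal (indicator C ((T ^^ N) x)) \<partial>M) = emeasure M C"
      using nn_integral_measure_preserving_map[OF measure_preserving_map_funpow[OF mp], of "\<lambda>x. ennreal (indicator C x)" N]
      by (simp add: ennreal_indicator)
    ultimately show ?thesis
      using hyp by (auto simp: H_def)
  qed
  have avg: "(\<lambda>x. (g x + h x) / 2) \<in> H" if g: "g \<in> H" and h: "h \<in> H" for g h
  proof -
    note [measurable] = Hm[OF g] Hm[OF h]
    have "e \<le> (\<integral>\<^sup>+x\<in>A. ennreal ((g ((T ^^ n) x) + h ((T ^^ n) x)) / 2) \<partial>M)" for n
      by (subst nn_integral_average) (auto simp: Hb[OF g] Hb[OF h] He[OF g] He[OF h] intro!: ennreal_average_bounds(1))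
    moreover have "(\<integral>\<^sup>+x. ennreal ((g x + h x) / 2) \<partial>M) \<le> emeasure M C"
    proof -
      have sp: "(\<integral>\<^sup>+x\<in>space M. k x \<partial>M) = (\<integral>\<^sup>+x. k x \<partial>M)" for k :: "'a \<Rightarrow> ennreal"
        by (intro nn_integral_cong) simp
      show ?thesis
        using nn_integral_average[OF Hm[OF g] Hm[OF h] sets.top Hb(1)[OF g] Hb(1)[OF h]]
        by (simp only: sp) (intro ennreal_average_bounds(2) Hi g h)
    qed
    moreover have "0 \<le> (g x + h x) / 2 \<and> (g x + h x) / 2 \<le> 1" for x
      using Hb[OF g, of x] Hb[OF h, of x] by auto
    ultimately show ?thesis by (simp add: H_def)
  qed
  have shift: "(\<lambda>x. g (T x)) \<in> H" if g: "g \<in> H" for g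
  proof -
    note [measurable] = Hm[OF g]
    have "e \<le> (\<integral>\<^sup>+x\<in>A. ennreal (g (T ((T ^^ n) x))) \<partial>M)" for n
      using He[OF g, of "Suc n"] by simp
    then show ?thesis
      using nn_integral_measure_preserving_map[OF mp, of "\<lambda>x. ennreal (g x)"] Hi[OF g] Hb[OF g]
      by (auto simp: H_def)
  qed

  have int: "integrable M (\<lambda>x. g x * h x)" if g: "g \<in> H" and h: "h \<in> H" for g h
  proof (rule Bochner_Integration.integrable_bound)
    note [measurable] = Hm[OF g] Hm[OF h]
    show "integrable M g"
      using Hi[OF g] Hb[OF g] fin by (intro integrableI_nonneg) (auto simp: top.not_eq_extremum)
    show "(\<lambda>x. g x * h x) \<in> borel_measurable M" by measurable
    show "AE x in M. norm (g x * h x) \<le> norm (g x)"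
      using Hb[OF g] Hb[OF h] by (simp add: abs_mult mult_left_le)
  qed
  define q where "q g = (\<integral>x. g x * g x \<partial>M)" for g :: "'a \<Rightarrow> real"
  define c where "c = Inf (q ` H)"
  have q0: "bdd_below (q ` H)"
    by (rule bdd_belowI2[of _ 0]) (auto simp: q_def intro!: integral_nonneg_AE)
  have c_le: "c \<le> q g" if "g \<in> H" for g
    unfolding c_def using q0 that by (intro cInf_lower) auto
  \<comment> \<open>the parallelogram law, as the average of two members of \<open>H\<close> lies in \<open>H\<close>\<close>
  have close: "(\<integral>\<^sup>+x. ennreal ((g x - h x)\<^sup>2) \<partial>M) \<le> ennreal (2 * (q g - c) + 2 * (q h - c))"
    if g: "g \<in> H" and h: "h \<in> H" for g h
  proof -
    let ?a = "\<lambda>x. (g x + h x) / 2"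
    have "(\<lambda>x. (g x - h x)\<^sup>2) = (\<lambda>x. 2 * (g x * g x) + 2 * (h x * h x) - 4 * (?a x * ?a x))"
      by (auto simp: power2_eq_square field_simps)
    moreover have bochner: "has_bochner_integral M (\<lambda>x. 2 * P x + 2 * Q x - 4 * R x)
        (2 * (\<integral>x. P x \<partial>M) + 2 * (\<integral>x. Q x \<partial>M) - 4 * (\<integral>x. R x \<partial>M))"
      if "integrable M P" "integrable M Q" "integrable M R" for P Q R :: "'a \<Rightarrow> real"
      using that by (simp add: has_bochner_integral_iff)
    ultimately have "has_bochner_integral M (\<lambda>x. (g x - h x)\<^sup>2) (2 * q g + 2 * q h - 4 * q ?a)"
      using bochner[OF int[OF g g] int[OF h h] int[OF avg[OF g h] avg[OF g h]]] by (simp only: q_def)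
    then have "(\<integral>\<^sup>+x. ennreal ((g x - h x)\<^sup>2) \<partial>M) = ennreal (2 * q g + 2 * q h - 4 * q ?a)"
      by (subst nn_integral_eq_integral) (auto simp only: has_bochner_integral_iff zero_le_power2 AE_I2)
    also have "\<dots> \<le> ennreal (2 * (q g - c) + 2 * (q h - c))"
      using c_le[OF avg[OF g h]] by (intro ennreal_leI) simp
    finally show ?thesis .
  qed
  \<comment> \<open>The minimising sequence gets a prescribed rate: by the parallelogram bound,
    squared distances between consecutive members are then at most 4 (1/4)^n, the form that the
    summability lemma takes.\<close>
  have "\<exists>g\<in>H. q g < c + (1/4) ^ n" for n :: nat
    using cInf_lessD[of "q ` H" "c + (1/4) ^ n"] base by (force simp: c_def)
  then obtain g where g: "\<And>n. g n \<in> H" and qg: "\<And>n. q (g n) < c + (1/4) ^ n" by metis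
  note [measurable] = Hm[OF g]

  have "AE x in M. summable (\<lambda>n. g (Suc n) x - g n x)"
  proof (rule AE_summable_of_square_integral[where K = 4])
    show "(\<integral>\<^sup>+x. ennreal ((g (Suc n) x - g n x)\<^sup>2) \<partial>M) \<le> ennreal (4 * (1/4) ^ n)" for n
      using qg[of n] qg[of "Suc n"]
      by (intro order_trans[OF close[OF g g]] ennreal_leI) (simp add: field_simps)
  qed auto
  then have conv: "AE x in M. (\<lambda>n. g n x) \<longlonglongrightarrow> lim (\<lambda>n. g n x)"
  proof eventually_elim
    case (elim x)
    then have "convergent (\<lambda>n. g n x - g 0 x)"
      by (simp only: summable_iff_convergent sum_lessThan_telescope[of "\<lambda>n. g n x"])
    then have "convergent (\<lambda>n. g n x)"
      using convergent_diff_const_right_iff[of "\<lambda>n. g n x" "g 0 x"] by simp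
    then show ?case by (simp add: convergent_LIMSEQ_iff)
  qed
  \<comment> \<open>Composition with \<open>T\<close> preserves \<open>q\<close>, so
    \<open>g n\<close> and its composite are equally close to the infimum and hence close to each
    other. Summable differences tend to 0, which makes the limit invariant.\<close>
  have "AE x in M. summable (\<lambda>n. g n (T x) - g n x)"
  proof (rule AE_summable_of_square_integral[where K = 4])
    have "q (\<lambda>x. g n (T x)) = q (g n)" for n
      unfolding q_def
      using integral_distr[OF T, of "\<lambda>x. g n x * g n x"] by (simp add: distr_measure_preserving_map[OF mp])
    then show "(\<integral>\<^sup>+x. ennreal ((g n (T x) - g n x)\<^sup>2) \<partial>M) \<le> ennreal (4 * (1/4) ^ n)" for n
      using qg[of n]
      by (intro order_trans[OF close[OF shift[OF g] g]] ennreal_leI) simp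
  qed auto
  then have inv: "AE x in M. lim (\<lambda>n. g n (T x)) = lim (\<lambda>n. g n x)"
    using conv AE_measure_preserving_map[OF mp conv]
  proof eventually_elim
    case (elim x)
    then have "lim (\<lambda>n. g n (T x)) - lim (\<lambda>n. g n x) = 0"
      by (intro LIMSEQ_unique[OF tendsto_diff[OF elim(3,2)] summable_LIMSEQ_zero[OF elim(1)]])
    then show ?case by simp
  qed
  have "(\<integral>\<^sup>+x. ennreal (lim (\<lambda>n. g n x)) \<partial>M) = (\<integral>\<^sup>+x. liminf (\<lambda>n. ennreal (g n x)) \<partial>M)"
    by (rule nn_integral_cong_AE) (use conv in eventually_elim, auto intro!: lim_imp_Liminf[symmetric])
  also have "\<dots> \<le> liminf (\<lambda>n. \<integral>\<^sup>+x. ennreal (g n x) \<partial>M)"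
    by (rule nn_integral_liminf) measurable
  also have "\<dots> \<le> liminf (\<lambda>n. emeasure M C)"
    by (intro Liminf_mono always_eventually allI Hi g)
  also have "\<dots> < \<infinity>" using fin by (simp add: Liminf_const top.not_eq_extremum)
  \<comment> \<open>Fatou's lemma has bounded the integral of the limit by
    \<open>emeasure M C\<close>, so the limit is an invariant function of finite integral.\<close>
  finally have "AE x in M. lim (\<lambda>n. g n x) \<le> 0"
    by (intro ergodic_infinite_AE_invariant_le_0[OF mp erg infinite _ inv]) auto
  with conv have "AE x in M. (\<lambda>n. ennreal (g n x) * indicator A x) \<longlonglongrightarrow> 0"
  proof eventually_elim
    case (elim x)
    moreover have "0 \<le> lim (\<lambda>n. g n x)"
      by (rule LIMSEQ_le_const[OF elim(1)]) (auto simp: Hb[OF g])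
    ultimately have "(\<lambda>n. ennreal (g n x)) \<longlonglongrightarrow> ennreal 0" by (metis tendsto_ennrealI order_antisym)
    then show ?case by (cases "x \<in> A") auto
  qed
  then have "(\<lambda>n. \<integral>\<^sup>+x\<in>A. ennreal (g n x) \<partial>M) \<longlonglongrightarrow> (\<integral>\<^sup>+x. 0 \<partial>M)"
    using Hb[OF g] fin
    by (intro nn_integral_dominated_convergence[where w = "indicator A"])
      (auto simp: top.not_eq_extremum split: split_indicator)
  \<comment> \<open>Index 0 in the constraint of \<open>H\<close> bounds the integral of
    \<open>g n\<close> itself from below, against the limit 0 obtained by domination with
    \<open>indicator A\<close>.\<close>
  moreover have "\<forall>n. e \<le> (\<integral>\<^sup>+x\<in>A. ennreal (g n x) \<partial>M)"
    using He[OF g, of _ 0] by simp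
  ultimately have "e \<le> 0" by (intro LIMSEQ_le_const) auto
  then show False using e by simp
qed

text \<open>The losses, the measures of A \<inter> T^{-n_k} C_k, are chosen to sum to at most half
  the measure of \<open>A\<close>. The whole union is removed, not only a tail, so the escape holds
  for every \<open>k\<close>.\<close>

lemma ergodic_infinite_escaping_subset:
  fixes C :: "nat \<Rightarrow> 'a set"
  assumes mp: "measure_preserving_map M T" and erg: "ergodic_map M T"
    and infinite: "emeasure M (space M) = \<infinity>"
    and A[measurable]: "A \<in> sets M" and finA: "emeasure M A \<noteq> \<infinity>" and posA: "emeasure M A > 0"
    and C[measurable]: "\<And>k. C k \<in> sets M" and finC: "\<And>k. emeasure M (C k) \<noteq> \<infinity>"
  obtains B n where "B \<in> sets M" "B \<subseteq> A" "emeasure M B > 0"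
    and "\<And>k::nat. k \<le> n k" and "\<And>k x. x \<in> B \<Longrightarrow> (T ^^ n k) x \<notin> C k"
proof -
  have Tn[measurable]: "T ^^ n \<in> measurable M M" for n
    using measure_preserving_map_measurable[OF measure_preserving_map_funpow[OF mp]] .
  define a where "a = measure M A"
  have a: "emeasure M A = ennreal a"
    using finA unfolding a_def by (intro emeasure_eq_ennreal_measure) simp
  with posA have "a > 0" by simp
  note a = a this
  have "\<exists>n\<ge>k. emeasure M (A \<inter> (T ^^ n) -` C k) < ennreal (a / 2 * (1/2) ^ Suc k)" for k
    using a by (intro ergodic_infinite_small_intersection[OF mp erg infinite A C finA finC]) simp
  then obtain n where n: "\<And>k. k \<le> n k"
    and small: "\<And>k. emeasure M (A \<inter> (T ^^ n k) -` C k) < ennreal (a / 2 * (1/2) ^ Suc k)"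
    by metis
  define E where "E k = A \<inter> (T ^^ n k) -` C k" for k
  have E: "E k \<in> sets M" for k
  proof -
    have "E k = A \<inter> ((T ^^ n k) -` C k \<inter> space M)"
      using sets.sets_into_space[OF A] by (auto simp: E_def)
    then show ?thesis by simp
  qed
  have "emeasure M (\<Union>k. E k) \<le> (\<Sum>k. emeasure M (E k))"
    using E by (intro emeasure_subadditive_countably) auto
  also have "\<dots> \<le> (\<Sum>k. ennreal (a / 2 * (1/2) ^ Suc k))"
    using small by (intro suminf_le) (auto simp: E_def intro: less_imp_le)
  also have "\<dots> = ennreal (a / 2)"
    using a sums_mult[OF power_half_series, of "a / 2"]
    by (subst suminf_ennreal2) (auto simp: sums_iff)
  finally have UE: "emeasure M (\<Union>k. E k) \<le> ennreal (a / 2)" .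
  have "emeasure M (A - (\<Union>k. E k)) > 0"
  proof (rule ccontr)
    assume "\<not> ?thesis"
    then have "emeasure M (A - (\<Union>k. E k)) = 0" by simp
    then have "emeasure M A \<le> emeasure M (\<Union>k. E k)"
      using emeasure_subadditive[of "A - (\<Union>k. E k)" M "\<Union>k. E k"]
        emeasure_mono[of A "(A - (\<Union>k. E k)) \<union> (\<Union>k. E k)" M] E A
      by (auto intro: order_trans)
    from order_trans[OF this UE] show False
      using a by (simp add: ennreal_le_iff)
  qed
  moreover have "A - (\<Union>k. E k) \<in> sets M" using E A by auto
  moreover have "(T ^^ n k) x \<notin> C k" if "x \<in> A - (\<Union>k. E k)" for k x
    using that by (auto simp: E_def)
  ultimately show thesis using that n by blast
qed

section \<open>Exceptional points and restriction of isomorphisms\<close>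

text \<open>These are the points of \<open>E\<close> outside the support of Lebesgue measure
  restricted to \<open>E\<close>. They form a locally negligible set, and local negligibility
  implies negligibility.\<close>

lemma negligible_not_density:
  fixes E :: "'a::euclidean_space set"
  shows "negligible {y \<in> E. \<exists>r>0. negligible (E \<inter> ball y r)}" (is "negligible ?S")
  unfolding locally_negligible_alt[of ?S]
proof
  fix y assume "y \<in> ?S"
  then obtain r where r: "r > 0" "negligible (E \<inter> ball y r)" and "y \<in> E" by auto
  have "openin (top_of_set ?S) (?S \<inter> ball y r)" by (simp add: openin_open_Int)
  moreover have "negligible (?S \<inter> ball y r)" by (rule negligible_subset[OF r(2)]) auto
  ultimately show "\<exists>U. openin (top_of_set ?S) U \<and> y \<in> U \<and> negligible U"
    using r \<open>y \<in> ?S\<close> by (meson IntI centre_in_ball)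
qed

text \<open>Serves to cut the model isomorphism down to a conull set and its image. The image is
  measurable because it is a preimage under the inverse map.\<close>

lemma measure_isomorphism_restrict_space:
  assumes iso: "measure_isomorphism M N \<phi>" and X: "X \<in> sets M"
  shows "\<phi> ` X \<in> sets N"
    and "measure_isomorphism (restrict_space M X) (restrict_space N (\<phi> ` X)) \<phi>"
proof -
  let ?\<psi> = "the_inv_into (space M) \<phi>"
  have bij: "bij_betw \<phi> (space M) (space N)" and m: "\<phi> \<in> measurable M N" "?\<psi> \<in> measurable N M"
    and eq: "\<And>A. A \<in> sets N \<Longrightarrow> emeasure M (\<phi> -` A \<inter> space M) = emeasure N A"
    using iso by (auto simp: measure_isomorphism_def)
  note inj = bij_betw_imp_inj_on[OF bij]
  have XM: "X \<subseteq> space M" using X by (rule sets.sets_into_space)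
  have "\<phi> ` X = ?\<psi> -` X \<inter> space N"
  proof (intro equalityI subsetI IntI vimageI2)
    fix y assume "y \<in> \<phi> ` X"
    then show "?\<psi> y \<in> X" "y \<in> space N"
      using XM bij by (auto simp: the_inv_into_f_f[OF inj] subset_iff bij_betw_def)
  next
    fix y assume y: "y \<in> ?\<psi> -` X \<inter> space N"
    then have "\<phi> (?\<psi> y) = y" using bij by (auto intro: f_the_inv_into_f[OF inj] simp: bij_betw_def)
    then show "y \<in> \<phi> ` X" using y by (metis IntD1 imageI vimageE)
  qed
  then show Y: "\<phi> ` X \<in> sets N" using measurable_sets[OF m(2) X] by simp
  have YN: "\<phi> ` X \<subseteq> space N" using Y by (rule sets.sets_into_space)
  have sp: "space (restrict_space M X) = X" "space (restrict_space N (\<phi> ` X)) = \<phi> ` X"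
    using XM YN by (auto simp: space_restrict_space)
  have inv_eq: "the_inv_into X \<phi> y = ?\<psi> y" if "y \<in> \<phi> ` X" for y
    using that XM inj by (auto simp: the_inv_into_f_f subset_iff inj_on_subset[OF inj XM])
  show "measure_isomorphism (restrict_space M X) (restrict_space N (\<phi> ` X)) \<phi>"
    unfolding measure_isomorphism_def sp
  proof (intro conjI ballI)
    show "bij_betw \<phi> X (\<phi> ` X)" using inj_on_subset[OF inj XM] by (rule inj_on_imp_bij_betw)
    show "\<phi> \<in> measurable (restrict_space M X) (restrict_space N (\<phi> ` X))"
      by (rule measurable_restrict_space3[OF m(1)]) auto
    have "?\<psi> \<in> measurable (restrict_space N (\<phi> ` X)) (restrict_space M X)"
      using XM by (intro measurable_restrict_space3[OF m(2)]) (auto simp: the_inv_into_f_f[OF inj] subset_iff)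
    then show "the_inv_into X \<phi> \<in> measurable (restrict_space N (\<phi> ` X)) (restrict_space M X)"
      by (rule measurable_cong[THEN iffD1, rotated]) (simp add: sp inv_eq)
    fix A assume "A \<in> sets (restrict_space N (\<phi> ` X))"
    then have A: "A \<in> sets N" "A \<subseteq> \<phi> ` X" using Y by (auto simp: sets_restrict_space_iff)
    then have "\<phi> -` A \<inter> X = \<phi> -` A \<inter> space M"
      using XM inj by (auto simp: inj_on_def subset_iff)
    moreover have "emeasure (restrict_space M X) (\<phi> -` A \<inter> X) = emeasure M (\<phi> -` A \<inter> X)"
      "emeasure (restrict_space N (\<phi> ` X)) A = emeasure N A"
      using X Y A XM YN by (auto simp: emeasure_restrict_space Int_absorb2)
    ultimately show "emeasure (restrict_space M X) (\<phi> -` A \<inter> X) = emeasure (restrict_space N (\<phi> ` X)) A"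
      using eq[OF A(1)] by simp
  qed
qed

section \<open>A metric on the line that shrinks neighbourhoods of infinity\<close>

text \<open>Inversion carries the vertical line Re w = 1 to the circle with centre 1/2 and radius
  1/2. The origin is the missing point of the circle and corresponds to infinity; the coordinate is
  recovered as Im (1/w).\<close>

definition line_to_circle :: "real \<Rightarrow> complex" where
  "line_to_circle x = inverse (1 + \<i> * complex_of_real x)"

text \<open>The chordal term brings the two ends of the line together; the jump makes
  \<open>P\<close> and its complement open without changing the topology on either. Since the jump
  is 1, open balls of radius at most 1 stay on one side.\<close>

definition split_dist :: "real set \<Rightarrow> real \<Rightarrow> real \<Rightarrow> real" where
  "split_dist P x y = dist (line_to_circle x) (line_to_circle y) + (if x \<in> P \<longleftrightarrow> y \<in> P then 0 else 1)"

lemma one_plus_ii_times_real_nonzero: "1 + \<i> * complex_of_real x \<noteq> 0"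
  by (simp add: complex_eq_iff)

lemma line_to_circle_nonzero: "line_to_circle x \<noteq> 0"
  by (simp add: line_to_circle_def one_plus_ii_times_real_nonzero)

lemma Im_inverse_line_to_circle: "Im (inverse (line_to_circle x)) = x"
  by (simp add: line_to_circle_def)

lemma isCont_line_to_circle: "isCont line_to_circle x"
  unfolding line_to_circle_def
  by (intro continuous_intros one_plus_ii_times_real_nonzero)

lemma norm_line_to_circle_le: "0 < k \<Longrightarrow> k \<le> \<bar>x\<bar> \<Longrightarrow> norm (line_to_circle x) \<le> 1 / k"
  using abs_Im_le_cmod[of "1 + \<i> * complex_of_real x"]
  unfolding line_to_circle_def norm_inverse inverse_eq_divide[symmetric] by (intro le_imp_inverse_le) auto

text \<open>Both images lie within 1/k of the origin, whichever end of the line the points are near,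
  and points on the same side incur no jump.\<close>

lemma split_dist_le:
  assumes "0 < k" "k \<le> \<bar>x\<bar>" "k \<le> \<bar>y\<bar>" "x \<in> P \<longleftrightarrow> y \<in> P"
  shows "split_dist P x y \<le> 2 / k"
  using norm_line_to_circle_le[OF assms(1,2)] norm_line_to_circle_le[OF assms(1,3)] assms(4)
    norm_triangle_ineq4[of "line_to_circle x" "line_to_circle y"]
  by (auto simp: split_dist_def dist_norm)

text \<open>The inverse Im (1/w) of the wrapping is continuous away from the origin, and radii at
  most 1 exclude the jump. Together with \<open>close_imp_split_dist_small\<close> this identifies
  the topology on each side as the Euclidean one.\<close>

lemma split_dist_small_imp_close:
  assumes "s > 0"
  shows "\<exists>r>0. \<forall>y. split_dist P x y < r \<longrightarrow> y \<in> ball x s \<and> (x \<in> P \<longleftrightarrow> y \<in> P)"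
proof -
  have "isCont (\<lambda>w. Im (inverse w)) (line_to_circle x)"
    by (intro isCont_Im continuous_at_within_inverse continuous_ident line_to_circle_nonzero)
  then obtain r where r: "r > 0"
    "\<And>w. dist w (line_to_circle x) < r \<Longrightarrow> dist (Im (inverse w)) (Im (inverse (line_to_circle x))) < s"
    using assms unfolding continuous_at_eps_delta by (metis dist_commute)
  show ?thesis
  proof (intro exI[of _ "min r 1"] conjI allI impI)
    fix y assume y: "split_dist P x y < min r 1"
    then have "x \<in> P \<longleftrightarrow> y \<in> P"
      by (smt (verit) split_dist_def zero_le_dist min_less_iff_conj)
    moreover from this y have "dist (line_to_circle y) (line_to_circle x) < r"
      by (simp add: split_dist_def dist_commute)
    from r(2)[OF this] have "y \<in> ball x s"
      unfolding Im_inverse_line_to_circle by (simp add: dist_commute)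
    ultimately show "y \<in> ball x s" "x \<in> P \<longleftrightarrow> y \<in> P" by simp_all
  qed (use r in simp)
qed

lemma close_imp_split_dist_small:
  assumes "r > 0"
  shows "\<exists>s>0. \<forall>y\<in>ball x s. (x \<in> P \<longleftrightarrow> y \<in> P) \<longrightarrow> split_dist P x y < r"
proof -
  from isCont_line_to_circle[of x] obtain s where s: "s > 0"
    "\<And>y. dist y x < s \<Longrightarrow> dist (line_to_circle y) (line_to_circle x) < r"
    using assms unfolding continuous_at_eps_delta by metis
  show ?thesis
    by (intro exI[of _ s] conjI s(1)) (use s(2) in \<open>auto simp: split_dist_def dist_commute\<close>)
qed

lemma Metric_space_split_dist: "Metric_space Z (split_dist P)"
proof
  fix x y z
  show "0 \<le> split_dist P x y" by (simp add: split_dist_def)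
  show "split_dist P x y = split_dist P y x" by (auto simp: split_dist_def dist_commute)
  show "split_dist P x y = 0 \<longleftrightarrow> x = y"
  proof
    assume "split_dist P x y = 0"
    then have "dist (line_to_circle x) (line_to_circle y) = 0"
      by (smt (verit) split_dist_def zero_le_dist)
    then show "x = y" by (metis Im_inverse_line_to_circle dist_eq_0_iff)
  qed (simp add: split_dist_def)
  show "split_dist P x z \<le> split_dist P x y + split_dist P y z"
    using dist_triangle[of "line_to_circle x" "line_to_circle z" "line_to_circle y"]
    by (auto simp: split_dist_def)
qed

text \<open>As the metric topology is Euclidean on each side, measurability and regularity reduce to
  those of Lebesgue measure on \<open>Z \<inter> P\<close> and \<open>Z - P\<close>. The hypothesis
  \<open>pos\<close> is positivity of the basic neighbourhoods of this topology.\<close>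

lemma good_metric_split_dist:
  assumes Z: "Z \<in> sets lebesgue" and P: "P \<in> sets lebesgue"
    and pos: "\<And>z r. z \<in> Z \<Longrightarrow> r > 0 \<Longrightarrow> emeasure lebesgue (Z \<inter> ball z r \<inter> {y. y \<in> P \<longleftrightarrow> z \<in> P}) > 0"
  shows "good_metric (lebesgue_on Z) (split_dist P)"
proof -
  interpret Metric_space Z "split_dist P" by (rule Metric_space_split_dist)
  let ?L = "lebesgue_on Z"
  have em: "emeasure ?L A = emeasure lebesgue A" if "A \<subseteq> Z" for A
    using Z that by (simp add: emeasure_restrict_space)
  have openD: "\<exists>s>0. Z \<inter> ball z s \<inter> {y. y \<in> P \<longleftrightarrow> z \<in> P} \<subseteq> U"
    if U: "openin mtopology U" and z: "z \<in> U" for U z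
  proof -
    from U z obtain r where r: "r > 0" "mball z r \<subseteq> U" "z \<in> Z"
      unfolding openin_mtopology by blast
    obtain s where "s > 0" "\<forall>y\<in>ball z s. (z \<in> P \<longleftrightarrow> y \<in> P) \<longrightarrow> split_dist P z y < r"
      using close_imp_split_dist_small[where P = P and x = z, OF r(1)] by blast
    with r show ?thesis by (intro exI[of _ s]) (auto simp: subset_iff)
  qed
  have openI: "openin mtopology (V \<inter> Z)" if V: "open V" for V
    unfolding openin_mtopology
  proof (intro conjI allI impI)
    fix z assume z: "z \<in> V \<inter> Z"
    then obtain s where s: "s > 0" "ball z s \<subseteq> V" using V by (auto simp: open_contains_ball)
    obtain r where "r > 0" "\<forall>y. split_dist P z y < r \<longrightarrow> y \<in> ball z s \<and> (z \<in> P \<longleftrightarrow> y \<in> P)"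
      using split_dist_small_imp_close[where P = P and x = z, OF s(1)] by blast
    with s z show "\<exists>r>0. mball z r \<subseteq> V \<inter> Z" by (intro exI[of _ r]) (auto simp: subset_iff)
  qed auto
  \<comment> \<open>Within one side the identity is continuous from the Euclidean topology to the
    metric one. A Euclidean compact set meeting both sides can fail to be compact here, hence
    \<open>side\<close>.\<close>
  have compactI: "compactin mtopology K"
    if K: "compact K" "K \<subseteq> Z" and side: "\<And>x y. x \<in> K \<Longrightarrow> y \<in> K \<Longrightarrow> x \<in> P \<longleftrightarrow> y \<in> P" for K
  proof -
    have "continuous_map (top_of_set K) mtopology id"
      unfolding continuous_map_to_metric
    proof (intro ballI allI impI)
      fix x r assume x: "x \<in> topspace (top_of_set K)" and r: "(r::real) > 0"
      obtain s where s: "s > 0" "\<forall>y\<in>ball x s. (x \<in> P \<longleftrightarrow> y \<in> P) \<longrightarrow> split_dist P x y < r"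
        using close_imp_split_dist_small[where P = P and x = x, OF r] by blast
      show "\<exists>U. openin (top_of_set K) U \<and> x \<in> U \<and> (\<forall>y\<in>U. id y \<in> mball (id x) r)"
      proof (intro exI[of _ "K \<inter> ball x s"] conjI ballI)
        fix y assume y: "y \<in> K \<inter> ball x s"
        then have "split_dist P x y < r" using s(2) side[of x y] x by auto
        then show "id y \<in> mball (id x) r" using y x K(2) by auto
      qed (use x s(1) in \<open>auto simp: openin_open_Int\<close>)
    qed
    moreover have "compactin (top_of_set K) K" using K by (simp add: compactin_subtopology)
    ultimately have "compactin mtopology (id ` K)" by (intro image_compactin)
    then show ?thesis by simp
  qed
  have open_meas: "U \<in> sets ?L" if U: "openin mtopology U" for U
  proof -
    have UZ: "U \<subseteq> Z" using U by (simp add: openin_mtopology)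
    \<comment> \<open>An open set of the metric may fail to be Euclidean open relative to
      \<open>Z\<close>, but its trace on each side is open relative to that side.\<close>
    have UQ: "U \<inter> Q \<in> sets lebesgue" if Q: "Q = P \<or> Q = - P" for Q
    proof (rule lebesgue_openin)
      show "openin (top_of_set (Z \<inter> Q)) (U \<inter> Q)"
        unfolding openin_contains_ball
      proof (intro conjI ballI)
        fix z assume z: "z \<in> U \<inter> Q"
        then obtain s where "s > 0" "Z \<inter> ball z s \<inter> {y. y \<in> P \<longleftrightarrow> z \<in> P} \<subseteq> U" using openD[OF U] by blast
        then show "\<exists>e>0. ball z e \<inter> (Z \<inter> Q) \<subseteq> U \<inter> Q" using z Q by (intro exI[of _ s]) auto
      qed (use UZ in auto)
      have "Q \<in> sets lebesgue" using P Q by (metis Compl_in_sets_lebesgue)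
      then show "Z \<inter> Q \<in> sets lebesgue" using Z by (rule sets.Int[rotated])
    qed
    have "U \<inter> P \<in> sets lebesgue" "U \<inter> - P \<in> sets lebesgue" using UQ by simp_all
    then have "(U \<inter> P) \<union> (U \<inter> - P) \<in> sets lebesgue" by (rule sets.Un)
    moreover have "(U \<inter> P) \<union> (U \<inter> - P) = U" by auto
    ultimately show ?thesis using UZ Z by (simp add: sets_restrict_space_iff)
  qed
  \<comment> \<open>Traces on \<open>Z\<close> of Euclidean open sets are open for the metric, so
    outer approximation for Lebesgue measure carries over.\<close>
  have outer: "emeasure ?L A = (INF U\<in>{U. openin mtopology U \<and> A \<subseteq> U}. emeasure ?L U)"
    if A: "A \<in> sets ?L" for A
  proof (rule antisym)
    show "emeasure ?L A \<le> (INF U\<in>{U. openin mtopology U \<and> A \<subseteq> U}. emeasure ?L U)"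
      using open_meas by (intro INF_greatest emeasure_mono) auto
    have AZ: "A \<subseteq> Z" "A \<in> sets lebesgue" using A Z by (auto simp: sets_restrict_space_iff)
    show "(INF U\<in>{U. openin mtopology U \<and> A \<subseteq> U}. emeasure ?L U) \<le> emeasure ?L A"
    proof (rule ennreal_le_epsilon)
      fix e :: real assume "0 < e"
      obtain V where V: "open V" "A \<subseteq> V" "V - A \<in> lmeasurable" "emeasure lebesgue (V - A) < ennreal e"
        by (rule sets_lebesgue_outer_open[OF AZ(2) \<open>0 < e\<close>])
      have "emeasure ?L (V \<inter> Z) \<le> emeasure lebesgue V"
        using V(1) by (subst em[OF Int_lower2], intro emeasure_mono) auto
      also have "\<dots> = emeasure lebesgue (A \<union> (V - A))" using V(2) by (simp add: Un_absorb1)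
      also have "\<dots> \<le> emeasure lebesgue A + emeasure lebesgue (V - A)"
        using AZ V by (intro emeasure_subadditive) auto
      also have "\<dots> \<le> emeasure ?L A + ennreal e"
        using V(4) by (intro add_mono) (auto simp: em[OF AZ(1)])
      finally show "(INF U\<in>{U. openin mtopology U \<and> A \<subseteq> U}. emeasure ?L U) \<le> emeasure ?L A + ennreal e"
        using openI[OF V(1)] V(2) AZ(1) by (intro INF_lower2[of "V \<inter> Z"]) auto
    qed
  qed
  \<comment> \<open>The two sides are approximated separately, each with error e/2, because
    compactness transfers only within one side.\<close>
  have inner: "emeasure ?L A = (SUP K\<in>{K. compactin mtopology K \<and> K \<subseteq> A}. emeasure ?L K)"
    (is "_ = ?S") if A: "A \<in> sets ?L" for A
  proof (rule antisym)
    show "?S \<le> emeasure ?L A"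
      using A by (intro SUP_least emeasure_mono) auto
    have AZ: "A \<subseteq> Z" "A \<in> sets lebesgue" using A Z by (auto simp: sets_restrict_space_iff)
    then have AP: "A \<inter> P \<in> sets lebesgue" "A - P \<in> sets lebesgue" using P by auto
    show "emeasure ?L A \<le> ?S"
    proof (rule ennreal_le_epsilon)
      fix e :: real assume e: "0 < e"
      then have e2: "0 < e / 2" by simp
      obtain F where F: "closed F" "F \<subseteq> A \<inter> P" "A \<inter> P - F \<in> lmeasurable"
          "emeasure lebesgue (A \<inter> P - F) < ennreal (e / 2)"
        by (rule sets_lebesgue_inner_closed[OF AP(1) e2])
      obtain G where G: "closed G" "G \<subseteq> A - P" "A - P - G \<in> lmeasurable"
          "emeasure lebesgue (A - P - G) < ennreal (e / 2)"
        by (rule sets_lebesgue_inner_closed[OF AP(2) e2])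
      \<comment> \<open>Intersecting with balls makes the closed sets compact; continuity from below
        recovers their full measure, finite or infinite.\<close>
      define K where "K n = F \<inter> cball 0 (real n) \<union> G \<inter> cball 0 (real n)" for n
      have K: "compactin mtopology (K n)" "K n \<subseteq> A" for n
      proof -
        show "compactin mtopology (K n)"
          unfolding K_def using F G AZ
          by (intro compactin_Un compactI closed_Int_compact compact_cball) auto
        show "K n \<subseteq> A" using F G by (auto simp: K_def)
      qed
      have FG: "F \<in> sets lebesgue" "G \<in> sets lebesgue" using F(1) G(1) by auto
      then have Km: "K n \<in> sets lebesgue" for n unfolding K_def by (intro sets.Un sets.Int) auto
      have "incseq K" by (auto simp: K_def incseq_def)
      have UK: "(\<Union>n. K n) = F \<union> G"
      proof (intro equalityI subsetI)
        fix x assume x: "x \<in> F \<union> G"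
        obtain n where "\<bar>x\<bar> \<le> real n" using real_arch_simple by blast
        with x have "x \<in> K n" by (auto simp: K_def)
        then show "x \<in> (\<Union>n. K n)" by blast
      qed (auto simp: K_def)
      have "emeasure lebesgue (F \<union> G) = (SUP n. emeasure lebesgue (K n))"
        using SUP_emeasure_incseq[of K lebesgue] Km \<open>incseq K\<close> by (simp add: UK image_subset_iff)
      also have "\<dots> \<le> ?S"
      proof (rule SUP_least)
        fix n
        have "emeasure lebesgue (K n) = emeasure ?L (K n)" using em[OF subset_trans[OF K(2) AZ(1)]] by simp
        also have "\<dots> \<le> ?S" using K by (intro SUP_upper) auto
        finally show "emeasure lebesgue (K n) \<le> ?S" .
      qed
      finally have *: "emeasure lebesgue (F \<union> G) \<le> ?S" .
      have "emeasure ?L A = emeasure lebesgue ((F \<union> G) \<union> ((A \<inter> P - F) \<union> (A - P - G)))"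
        using F(2) G(2) by (subst em[OF AZ(1)]) (auto intro!: arg_cong[where f = "emeasure lebesgue"])
      also have "\<dots> \<le> emeasure lebesgue (F \<union> G) + emeasure lebesgue ((A \<inter> P - F) \<union> (A - P - G))"
        using FG AP by (intro emeasure_subadditive) auto
      also have "\<dots> \<le> emeasure lebesgue (F \<union> G) + (emeasure lebesgue (A \<inter> P - F) + emeasure lebesgue (A - P - G))"
        using FG AP by (intro add_left_mono emeasure_subadditive) auto
      also have "\<dots> \<le> ?S + (ennreal (e/2) + ennreal (e/2))"
        using F(4) G(4) by (intro add_mono *) auto
      also have "ennreal (e/2) + ennreal (e/2) = ennreal e"
        using e by (subst ennreal_plus[symmetric]) auto
      finally show "emeasure ?L A \<le> ?S + ennreal e" .
    qed
  qed
  have pos_open: "emeasure ?L U > 0" if U: "openin mtopology U" "U \<noteq> {}" for U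
  proof -
    have UZ: "U \<subseteq> Z" using U by (simp add: openin_mtopology)
    from U obtain z where z: "z \<in> U" by auto
    then obtain s where s: "s > 0" "Z \<inter> ball z s \<inter> {y. y \<in> P \<longleftrightarrow> z \<in> P} \<subseteq> U" using openD[OF U(1)] by blast
    have "0 < emeasure lebesgue (Z \<inter> ball z s \<inter> {y. y \<in> P \<longleftrightarrow> z \<in> P})"
      using z UZ s(1) by (intro pos) auto
    also have "\<dots> = emeasure ?L (Z \<inter> ball z s \<inter> {y. y \<in> P \<longleftrightarrow> z \<in> P})" by (subst em) auto
    also have "\<dots> \<le> emeasure ?L U" using s(2) open_meas[OF U(1)] by (intro emeasure_mono)
    finally show ?thesis .
  qed
  have space: "space ?L = Z" by simp
  show ?thesis
    unfolding good_metric_def regular_for_metric_def space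
    by (intro conjI ballI allI impI Metric_space_axioms)
      (blast intro: open_meas pos_open | rule outer inner, assumption)+
qed

section \<open>Realisation on the line and failure of sensitivity\<close>

lemma emeasure_eq_0_if_AE_notin:
  "AE x in M. x \<notin> A \<Longrightarrow> A \<in> sets M \<Longrightarrow> emeasure M A = 0"
  by (rule null_setsD1, subst AE_iff_null_sets)

theorem proposition5p1:
  fixes M :: "'a measure" and T :: "'a \<Rightarrow> 'a"
  assumes "lebesgue_space M"
    and "nonatomic M"
    and "sigma_finite_measure M"
    and "emeasure M (space M) = \<infinity>"
    and "measure_preserving_map M T"
    and "ergodic_map M T"
  shows "\<not> measurably_sensitive TYPE(real) M T"
proof
  assume sens: "measurably_sensitive TYPE(real) M T"
  note infinite = assms(4) and mpT = assms(5) and erg = assms(6)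
  have Tn[measurable]: "T ^^ n \<in> measurable M M" for n
    using measure_preserving_map_measurable[OF measure_preserving_map_funpow[OF mpT]] .

  \<comment> \<open>Passage from the Lebesgue space to an interval\<close>
  obtain C D \<phi> and I :: "real set" where C[measurable]: "C \<in> sets M" and D: "D \<in> sets M"
    and null: "emeasure M (space M - (C \<union> D)) = 0"
    and atoms: "\<forall>x\<in>D. {x} \<in> sets M \<and> emeasure M {x} > 0"
    and I: "is_interval I" and iso: "measure_isomorphism (restrict_space M C) (lebesgue_on I) \<phi>"
    using assms(1) unfolding lebesgue_space_def by blast
  have "D = {}"
  proof (rule ccontr)
    assume "D \<noteq> {}"
    then obtain x where x: "x \<in> D" by blast
    have "emeasure M B = 0 \<or> emeasure M ({x} - B) = 0" if "B \<subseteq> {x}" for B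
      using that by (auto simp: subset_singleton_iff)
    with bspec[OF atoms x] show False using assms(2) unfolding nonatomic_def by blast
  qed
  with null have "AE x in M. x \<notin> space M - C" by (intro AE_not_in) (auto simp: null_sets_def)
  then have AE_C: "AE x in M. x \<in> C" using AE_space by eventually_elim auto
  have CM: "C \<subseteq> space M" using C by (rule sets.sets_into_space)
  have I_leb: "I \<in> sets lebesgue" using real_interval_borel_measurable[OF I] by simp

  have sets_restrict: "X \<in> sets (restrict_space M C)" if "X \<in> sets M" "X \<subseteq> C" for X
    using that by (simp add: sets_restrict_space_iff)
  have sp: "space (restrict_space M C) = C" "space (lebesgue_on I) = I"
    using CM by (auto simp: space_restrict_space)
  have bij: "bij_betw \<phi> C I" and \<phi>: "\<phi> \<in> measurable (restrict_space M C) (lebesgue_on I)"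
    using iso by (simp_all add: measure_isomorphism_def sp)
  note inj = bij_betw_imp_inj_on[OF bij]
  have vimage: "{x \<in> C. \<phi> x \<in> B} \<in> sets M" "emeasure M {x \<in> C. \<phi> x \<in> B} = emeasure lebesgue (B \<inter> I)"
    if B: "B \<in> sets lebesgue" for B
  proof -
    have B': "B \<inter> I \<in> sets (lebesgue_on I)" using B I_leb by (simp add: sets_restrict_space_iff)
    have eq: "\<phi> -` (B \<inter> I) \<inter> C = {x \<in> C. \<phi> x \<in> B}" using bij by (auto simp: bij_betw_def)
    show "{x \<in> C. \<phi> x \<in> B} \<in> sets M"
      using measurable_sets[OF \<phi> B'] C CM unfolding sp eq
      by (simp add: sets_restrict_space_iff Int_absorb2)
    have "emeasure (restrict_space M C) (\<phi> -` (B \<inter> I) \<inter> C) = emeasure (lebesgue_on I) (B \<inter> I)"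
      using iso B' unfolding measure_isomorphism_def sp by blast
    then show "emeasure M {x \<in> C. \<phi> x \<in> B} = emeasure lebesgue (B \<inter> I)"
      using C I_leb CM unfolding eq by (simp add: emeasure_restrict_space Int_absorb2)
  qed
  have image: "\<phi> ` X \<in> sets lebesgue" if "X \<in> sets M" "X \<subseteq> C" for X
    using measure_isomorphism_restrict_space(1)[OF iso sets_restrict[OF that]] I_leb
    by (simp add: sets_restrict_space_iff)

  \<comment> \<open>A bounded set that escapes to infinity\<close>
  define core where "core k = {x \<in> C. \<phi> x \<in> {- real k..real k}}" for k
  have core: "core k \<in> sets M" "emeasure M (core k) \<noteq> \<infinity>" for k
  proof -
    have "emeasure lebesgue ({- real k..real k} \<inter> I) \<le> emeasure lebesgue {- real k..real k}"
      by (intro emeasure_mono) auto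
    also have "\<dots> < \<infinity>" by simp
    finally show "emeasure M (core k) \<noteq> \<infinity>" unfolding core_def by (subst vimage(2)) auto
    show "core k \<in> sets M" unfolding core_def by (intro vimage(1)) auto
  qed
  \<comment> \<open>The cores exhaust \<open>C\<close>, which is conull in a space of infinite
    measure, so one of them is non-null. Starting inside a single core keeps the image of the
    escaping set bounded.\<close>
  obtain k0 where k0: "emeasure M (core k0) > 0"
  proof (rule ccontr)
    assume "\<not> thesis"
    then have "emeasure M (core k) = 0" for k using that by (metis not_gr_zero)
    then have "(\<Union>k. core k) \<in> null_sets M" using core(1) by (intro null_sets_UN) auto
    moreover have "(\<Union>k. core k) = C"
    proof -
      have "\<exists>k. - real k \<le> r \<and> r \<le> real k" for r :: real
      proof -
        obtain k where "\<bar>r\<bar> \<le> real k" using real_arch_simple by blast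
        then have "- real k \<le> r \<and> r \<le> real k" by (simp add: abs_le_iff)
        then show ?thesis ..
      qed
      then show ?thesis by (auto simp: core_def)
    qed
    ultimately have "AE x in M. x \<notin> C" by (simp add: AE_not_in)
    with AE_C have "AE x in M. False" by eventually_elim simp
    then show False using infinite by (simp add: AE_iff_null null_sets_def)
  qed
  obtain B0 n where B0: "B0 \<in> sets M" "B0 \<subseteq> core k0" "emeasure M B0 > 0"
    and n: "\<And>k::nat. k \<le> n k" and escape: "\<And>k x. x \<in> B0 \<Longrightarrow> (T ^^ n k) x \<notin> core k"
    using ergodic_infinite_escaping_subset[where C = core, OF mpT erg infinite core k0 core] by metis
  have B0C: "B0 \<subseteq> C" using B0(2) by (auto simp: core_def)

  \<comment> \<open>Discarding null sets to obtain a good metric\<close>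
  define P where "P = \<phi> ` B0"
  have P: "P \<in> sets lebesgue" unfolding P_def by (rule image[OF B0(1) B0C])
  have P_bounded: "P \<subseteq> {- real k0..real k0}" using B0(2) by (auto simp: P_def core_def)
  \<comment> \<open>points with a relatively null neighbourhood on their own side of \<open>P\<close>; removing them makes
    nonempty open sets of the new metric non-null\<close>
  define bad where "bad = {y \<in> I. \<exists>r>0. negligible (I \<inter> ball y r \<inter> {w. w \<in> P \<longleftrightarrow> y \<in> P})}"
  have "negligible bad"
  proof (rule negligible_subset)
    show "negligible ({y \<in> I \<inter> P. \<exists>r>0. negligible (I \<inter> P \<inter> ball y r)} \<union>
        {y \<in> I - P. \<exists>r>0. negligible ((I - P) \<inter> ball y r)})"
      by (intro negligible_Un negligible_not_density)
    have "I \<inter> ball y r \<inter> {w. w \<in> P \<longleftrightarrow> y \<in> P} = (if y \<in> P then I \<inter> P \<inter> ball y r else (I - P) \<inter> ball y r)" for y r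
      by auto
    then show "bad \<subseteq> {y \<in> I \<inter> P. \<exists>r>0. negligible (I \<inter> P \<inter> ball y r)} \<union>
        {y \<in> I - P. \<exists>r>0. negligible ((I - P) \<inter> ball y r)}"
      by (auto simp: bad_def)
  qed
  then have bad: "bad \<in> null_sets lebesgue" by (simp add: negligible_iff_null_sets)

  define G where "G = {x \<in> C. \<phi> x \<in> - bad}"
  have G[measurable]: "G \<in> sets M"
    unfolding G_def using bad by (intro vimage(1)) (auto simp: Compl_in_sets_lebesgue)
  have AE_G: "AE x in M. x \<in> G"
  proof -
    have "emeasure lebesgue (bad \<inter> I) = 0"
      using bad I_leb by (metis null_setsD1 null_set_Int2)
    then have "{x \<in> C. \<phi> x \<in> bad} \<in> null_sets M"
      using bad vimage[of bad] by (auto simp: null_sets_def)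
    from AE_not_in[OF this] AE_C show ?thesis by eventually_elim (auto simp: G_def)
  qed
  \<comment> \<open>Requiring the whole forward orbit to stay in \<open>G\<close> makes the set
    forward invariant, and it remains conull as a countable intersection of conull sets.\<close>
  define X where "X = {x \<in> space M. \<forall>n. (T ^^ n) x \<in> G}"
  have X: "X \<in> sets M" unfolding X_def by measurable
  have "AE x in M. \<forall>n. (T ^^ n) x \<in> G"
    using AE_measure_preserving_map[OF measure_preserving_map_funpow[OF mpT] AE_G]
    by (simp add: AE_all_countable)
  then have AE_X: "AE x in M. x \<in> X" using AE_space by eventually_elim (simp add: X_def)
  have XG: "X \<subseteq> G" unfolding X_def by (auto dest: spec[of _ 0])
  then have XC: "X \<subseteq> C" by (auto simp: G_def)
  have TX: "T x \<in> X" if "x \<in> X" for x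
  proof -
    have "(T ^^ n) (T x) \<in> G" for n
      using that funpow_swap1[of T n x] by (auto simp: X_def dest: spec[of _ "Suc n"])
    then show ?thesis
      using that measurable_space[OF measure_preserving_map_measurable[OF mpT]] by (auto simp: X_def)
  qed
  have TnX: "(T ^^ n) x \<in> X" if "x \<in> X" for x n
    using that by (induction n) (auto intro: TX)

  define Z where "Z = \<phi> ` X"
  have Z: "Z \<in> sets lebesgue" unfolding Z_def by (rule image[OF X XC])
  have ZI: "Z \<subseteq> I" using bij XC by (auto simp: Z_def bij_betw_def)
  have Z_iso: "measure_isomorphism (restrict_space M X) (lebesgue_on Z) \<phi>"
  proof -
    have "restrict_space (restrict_space M C) X = restrict_space M X"
      "restrict_space (lebesgue_on I) Z = lebesgue_on Z"
      using C X I_leb Z ZI XC by (simp_all add: restrict_restrict_space Int_absorb1 Int_absorb2)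
    then show ?thesis
      using measure_isomorphism_restrict_space(2)[OF iso sets_restrict[OF X XC]] by (simp add: Z_def)
  qed
  \<comment> \<open>Bad points were tested against \<open>I\<close>; since passing to
    \<open>Z\<close> loses only a null set, the neighbourhoods keep their positive measure.\<close>
  have IZ: "I - Z \<in> null_sets lebesgue"
  proof -
    have "{x \<in> C. \<phi> x \<in> I - Z} = C - X"
      using inj XC bij by (auto simp: Z_def inj_on_def bij_betw_def)
    moreover have "emeasure M (C - X) = 0"
    proof -
      have "AE x in M. x \<notin> C - X" using AE_X by eventually_elim simp
      then show ?thesis using C X by (intro emeasure_eq_0_if_AE_notin sets.Diff)
    qed
    moreover have "(I - Z) \<inter> I = I - Z" by auto
    ultimately show ?thesis using vimage(2)[of "I - Z"] I_leb Z by (auto simp: null_sets_def)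
  qed
  have good: "good_metric (lebesgue_on Z) (split_dist P)"
  proof (rule good_metric_split_dist[OF Z P])
    fix z and r :: real assume z: "z \<in> Z" and r: "r > 0"
    let ?Q = "{y. y \<in> P \<longleftrightarrow> z \<in> P}"
    have Q: "?Q \<in> sets lebesgue"
    proof -
      have "?Q = (if z \<in> P then P else - P)" by auto
      then show ?thesis using P by (auto simp: Compl_in_sets_lebesgue)
    qed
    have "z \<in> I" "z \<notin> bad" using z ZI XG by (auto simp: Z_def G_def)
    then have "\<not> negligible (I \<inter> ball z r \<inter> ?Q)" using r by (auto simp: bad_def)
    moreover have m: "I \<inter> ball z r \<inter> ?Q \<in> sets lebesgue" using I_leb Q by (intro sets.Int) auto
    ultimately have "emeasure lebesgue (I \<inter> ball z r \<inter> ?Q) > 0"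
      by (simp add: negligible_iff_null_sets null_sets_def zero_less_iff_neq_zero del: emeasure_completion)
    also have "emeasure lebesgue (I \<inter> ball z r \<inter> ?Q) = emeasure lebesgue (I \<inter> ball z r \<inter> ?Q - (I - Z))"
      using emeasure_Diff_null_set[OF IZ m] by simp
    also have "I \<inter> ball z r \<inter> ?Q - (I - Z) = Z \<inter> ball z r \<inter> ?Q" using ZI by auto
    finally show "0 < emeasure lebesgue (Z \<inter> ball z r \<inter> ?Q)" .
  qed

  \<comment> \<open>The system transported to the line\<close>
  define S where "S z = \<phi> (T (the_inv_into X \<phi> z))" for z
  have injX: "inj_on \<phi> X" using inj XC by (rule inj_on_subset)
  have spX: "space (restrict_space M X) = X"
    using X by (simp add: space_restrict_space sets.sets_into_space Int_absorb2)
  have S\<phi>: "S (\<phi> x) = \<phi> (T x)" if "x \<in> X" for x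
    using that by (simp add: S_def the_inv_into_f_f[OF injX])
  have Sn\<phi>: "(S ^^ n) (\<phi> x) = \<phi> ((T ^^ n) x)" if "x \<in> X" for x n
  proof (induction n)
    case (Suc n)
    then show ?case using S\<phi>[OF TnX[OF that]] by simp
  qed simp
  have S_meas: "S \<in> measurable (lebesgue_on Z) (lebesgue_on Z)"
  proof -
    have m: "\<phi> \<in> measurable (restrict_space M X) (lebesgue_on Z)"
      "the_inv_into X \<phi> \<in> measurable (lebesgue_on Z) (restrict_space M X)"
      using Z_iso by (simp_all add: measure_isomorphism_def spX)
    have "T \<in> measurable (restrict_space M X) (restrict_space M X)"
      using measure_preserving_map_measurable[OF mpT] by (rule measurable_restrict_space3) (simp add: TX)
    from measurable_compose[OF measurable_compose[OF m(2) this] m(1)] show ?thesis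
      by (simp only: S_def[abs_def])
  qed
  have systems_iso: "systems_isomorphic M T (lebesgue_on Z) S"
    unfolding systems_isomorphic_def
  proof (intro bexI exI conjI ballI)
    show "X \<in> sets M" by (rule X)
    show "Z \<in> sets (lebesgue_on Z)" using sets.top[of "lebesgue_on Z"] by simp
    show "emeasure M (space M - X) = 0"
    proof -
      have "AE x in M. x \<notin> space M - X" using AE_X by eventually_elim simp
      then show ?thesis using X by (intro emeasure_eq_0_if_AE_notin sets.compl_sets)
    qed
    show "T ` X \<subseteq> X" using TX by auto
    show "S ` Z \<subseteq> Z" using TX by (auto simp: Z_def S\<phi>)
    have "restrict_space (lebesgue_on Z) Z = lebesgue_on Z"
      using Z by (subst restrict_restrict_space) simp_all
    then show "measure_isomorphism (restrict_space M X) (restrict_space (lebesgue_on Z) Z) \<phi>"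
      using Z_iso by (simp only:)
    show "\<phi> (T x) = S (\<phi> x)" if "x \<in> X" for x using S\<phi>[OF that] by simp
  qed simp
  have space: "space (lebesgue_on Z) = Z" by simp
  have "\<exists>\<delta>>0. \<forall>z\<in>Z. \<forall>\<epsilon>>0. \<exists>n0::nat. \<forall>n\<ge>n0.
      emeasure (lebesgue_on Z) {y \<in> Metric_space.mball Z (split_dist P) z \<epsilon>.
        split_dist P ((S ^^ n) z) ((S ^^ n) y) > \<delta>} > 0"
    by (rule sens[unfolded measurably_sensitive_def, THEN spec[of _ "lebesgue_on Z"], THEN spec[of _ S],
          THEN spec[of _ "split_dist P"], THEN mp, OF conjI[OF S_meas conjI[OF systems_iso good]], unfolded space])
  then obtain \<delta> where \<delta>: "\<delta> > 0"
    and sensitive: "\<forall>z\<in>Z. \<forall>\<epsilon>>0. \<exists>n0::nat. \<forall>n\<ge>n0.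
        emeasure (lebesgue_on Z) {y \<in> Metric_space.mball Z (split_dist P) z \<epsilon>.
          split_dist P ((S ^^ n) z) ((S ^^ n) y) > \<delta>} > 0"
    by blast

  \<comment> \<open>Contradiction with sensitivity\<close>
  have "B0 \<inter> X \<noteq> {}"
  proof
    assume "B0 \<inter> X = {}"
    with AE_X have "AE x in M. x \<notin> B0" by (auto elim!: eventually_mono)
    then have "emeasure M B0 = 0" using B0(1) by (rule emeasure_eq_0_if_AE_notin)
    then show False using B0(3) by simp
  qed
  then obtain x where x: "x \<in> B0" "x \<in> X" by blast
  have "\<phi> x \<in> Z" using x by (simp add: Z_def)
  \<comment> \<open>Radius 1 is the size of the jump, so the ball around \<phi> x lies inside
    \<open>P\<close>.\<close>
  then obtain n0 where n0: "\<And>n. n \<ge> n0 \<Longrightarrow>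
      emeasure (lebesgue_on Z) {y \<in> Metric_space.mball Z (split_dist P) (\<phi> x) 1.
          split_dist P ((S ^^ n) (\<phi> x)) ((S ^^ n) y) > \<delta>} > 0"
    using sensitive zero_less_one by blast
  obtain k1 :: nat where k1: "2 / \<delta> < real k1" using reals_Archimedean2 by blast
  \<comment> \<open>\<open>k1\<close> makes 2/k at most \<delta>, \<open>n0\<close> makes the time
    \<open>n k\<close> late enough, \<open>k0\<close> puts points beyond k outside \<open>P\<close>,
    and 1 keeps k positive.\<close>
  define k where "k = Max {k1, n0, k0, 1}"
  have k: "k1 \<le> k" "n0 \<le> k" "k0 \<le> k" "1 \<le> k" by (simp_all add: k_def)
  have far: "real k \<le> \<bar>\<phi> ((T ^^ n k) w)\<bar>" "\<phi> ((T ^^ n k) w) \<notin> P" if "w \<in> B0" "w \<in> X" for w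
  proof -
    have "(T ^^ n k) w \<in> C" using TnX[OF that(2)] XC by auto
    with escape[OF that(1), of k] have "\<not> \<bar>\<phi> ((T ^^ n k) w)\<bar> \<le> real k" by (auto simp: core_def abs_le_iff)
    then show "real k \<le> \<bar>\<phi> ((T ^^ n k) w)\<bar>" "\<phi> ((T ^^ n k) w) \<notin> P"
      using P_bounded k(3) by (auto simp: subset_iff abs_le_iff)
  qed
  \<comment> \<open>Every point of the ball is the image of a point of \<open>B0\<close>, so at time
    \<open>n k\<close> both orbits are outside \<open>core k\<close> and outside \<open>P\<close>.
    The set of separated points is therefore empty, not merely null.\<close>
  have "split_dist P ((S ^^ n k) (\<phi> x)) ((S ^^ n k) y) \<le> \<delta>"
    if y: "y \<in> Metric_space.mball Z (split_dist P) (\<phi> x) 1" for y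
  proof -
    have "y \<in> Z" "split_dist P (\<phi> x) y < 1"
      using y by (simp_all add: Metric_space.in_mball[OF Metric_space_split_dist])
    then obtain w where w: "w \<in> X" "y = \<phi> w" by (auto simp: Z_def)
    have "\<phi> x \<in> P" using x by (simp add: P_def)
    with \<open>split_dist P (\<phi> x) y < 1\<close> have "y \<in> P"
      by (smt (verit) split_dist_def zero_le_dist)
    with w have wB: "w \<in> B0" using inj B0C XC by (auto simp: P_def inj_on_def subset_iff)
    have "split_dist P (\<phi> ((T ^^ n k) x)) (\<phi> ((T ^^ n k) w)) \<le> 2 / real k"
      using far[OF x] far[OF wB w(1)] k(4) by (intro split_dist_le) auto
    also have "\<dots> \<le> \<delta>"
    proof -
      have "2 / \<delta> \<le> real k" using k1 k(1) by linarith
      then show ?thesis using \<delta> k(4) by (simp add: field_simps)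
    qed
    finally show ?thesis using w x by (simp add: Sn\<phi>)
  qed
  then have "{y \<in> Metric_space.mball Z (split_dist P) (\<phi> x) 1.
      split_dist P ((S ^^ n k) (\<phi> x)) ((S ^^ n k) y) > \<delta>} = {}"
    by (auto simp: not_less)
  moreover have "n0 \<le> n k" using k(2) n[of k] by (rule order_trans)
  ultimately show False using n0[of "n k"] by (metis emeasure_empty less_irrefl)
qed

end
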